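(* For any distinct $\lambda,\mu\in\overline{\mathbb{D}}\setminus\{0\}$, the Landau constant $L(\lambda,\mu)$ for the class $\mathcal{M}_1(\lambda,\mu)$ is infinite, i.e. $L(\lambda,\mu)=\infty$.
   Context: Let $\mathbb{D}=\{z\in\mathbb{C}:|z|<1\}$. For distinct $\lambda,\mu\in\overline{\mathbb{D}}\setminus\{0\}$, $\mathcal{M}_1(\lambda,\mu)$ is the class of all meromorphic functions $f$ in $\mathbb{D}$ having two simple poles, at $z=\lambda$ and $z=\mu$, analytic at all other points of $\mathbb{D}$, and normalized by $f'(0)=1$. If $\lambda$ (or $\mu$) lies on $\partial\mathbb{D}$, having a simple pole there means that near that point $\lambda$ one has $f(z)=h(z)/(z-\lambda)$ with $h$ analytic at $\lambda$ and $h(\lambda)\neq0$ (similarly for $\mu$). For $f\in\mathcal{M}_1(\lambda,\mu)$, $L_f(\lambda,\mu)$ is the radius of the largest disk contained in $f(\mathbb{D})$, i.e. the supremum in $[0,\infty]$ of the radii of open Euclidean disks in $\mathbb{C}$ contained in $f(\mathbb{D})$. The Landau constant of the class is $L(\lambda,\mu)=\inf\{L_f(\lambda,\mu):f\in\mathcal{M}_1(\lambda,\mu)\}$. *)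

theory Defs
  imports "HOL-Complex_Analysis.Complex_Analysis" "HOL-Library.Extended_Nonnegative_Real"
begin

text \<open>
  A meromorphic function in the open unit disc is represented by a total function whose values at
  its poles and outside the disc carry no information.  At a point of the unit circle only the
  values inside the disc are available, hence the filter \<open>at p within ball 0 1\<close>; there \<open>h\<close> is
  required to be analytic in a full neighbourhood of \<open>p\<close>.
\<close>

definition disc_simple_pole :: "(complex \<Rightarrow> complex) \<Rightarrow> complex \<Rightarrow> bool" where
  "disc_simple_pole f p \<longleftrightarrow>
     (if p \<in> ball 0 1
      then is_pole f p \<and> zorder f p = -1
      else \<exists>h. h analytic_on {p} \<and> h p \<noteq> 0 \<and>
             (\<forall>\<^sub>F z in at p within ball 0 1. f z = h z / (z - p)))"

definition class_M1 :: "complex \<Rightarrow> complex \<Rightarrow> (complex \<Rightarrow> complex) set" where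
  "class_M1 l m =
     {f. f meromorphic_on ball 0 1 \<and>
         f analytic_on (ball 0 1 - {l, m}) \<and>
         disc_simple_pole f l \<and> disc_simple_pole f m \<and>
         deriv f 0 = 1}"

text \<open>
  The poles are removed from the disc before taking the image: the function has the value
  infinity there, which lies in no Euclidean disc, whereas the total function representing it has
  some arbitrary complex value.
\<close>

definition landau_radius :: "complex \<Rightarrow> complex \<Rightarrow> (complex \<Rightarrow> complex) \<Rightarrow> ennreal" where
  "landau_radius l m f =
     Sup {ennreal r | r. r > 0 \<and> (\<exists>c. ball c r \<subseteq> f ` (ball 0 1 - {l, m}))}"

definition landau_constant :: "complex \<Rightarrow> complex \<Rightarrow> ennreal" where
  "landau_constant l m = (INF f\<in>class_M1 l m. landau_radius l m f)"

end

theory Submission imports Defs begin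

text \<open>
  A simple pole by itself makes the image contain arbitrarily large disks, whether the pole lies
  inside the disc or on the unit circle.  Let \<open>f z = h z / (z - l)\<close> near \<open>l\<close>, with \<open>h l \<noteq> 0\<close>.
  The derivative at \<open>a\<close> grows like \<open>norm (h l) / norm (a - l) ^ 2\<close>, whereas Bloch's theorem, applied
  on a disk of radius \<open>norm (a - l)\<close> about \<open>a\<close>, yields a disk in the image of radius comparable to
  \<open>norm (a - l) * norm (deriv f a)\<close>.  This product tends to infinity as \<open>a\<close> tends to \<open>l\<close>
  (\<open>scaled_deriv_at_simple_pole\<close>), so only the disk about \<open>a\<close> has to stay inside the domain.
  It does when \<open>a\<close> approaches \<open>l\<close> along the radius from the origin
  (\<open>radial_ball_subset_punctured_disc\<close>): no point of that radius is closer to the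
  unit circle than to \<open>l\<close>.
\<close>

text \<open>
  For an interior pole this is the local factorization of a meromorphic function; for a boundary
  pole it is the definition.  From here on the two kinds of poles are treated alike.
\<close>

lemma disc_simple_pole_factor:
  assumes "f meromorphic_on ball 0 1" and "disc_simple_pole f p"
  obtains h where "h analytic_on {p}" "h p \<noteq> 0"
    "\<forall>\<^sub>F z in at p within ball 0 1. f z = h z / (z - p)"
proof (cases "p \<in> ball 0 1")
  case True
  with assms(2) have pole: "is_pole f p" and ord: "zorder f p = -1"
    by (auto simp: disc_simple_pole_def)
  have "isolated_singularity_at f p"
    using assms(1) True by (auto simp: meromorphic_on_altdef)
  then obtain e where e: "e > 0" "f holomorphic_on ball p e - {p}"
    using analytic_imp_holomorphic unfolding isolated_singularity_at_def by blast
  obtain r where r: "r > 0" "zor_poly f p holomorphic_on cball p r" "zor_poly f p p \<noteq> 0"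
      "\<forall>w\<in>cball p r - {p}. f w = zor_poly f p w / (w - p)"
    using zorder_exist_pole[OF e(2) _ _ pole] e(1) by (auto simp: ord)
  show ?thesis
  proof
    have "zor_poly f p holomorphic_on ball p r"
      using r(2) ball_subset_cball by (rule holomorphic_on_subset)
    then show "zor_poly f p analytic_on {p}"
      using r(1) by (auto simp: analytic_at intro!: exI[of _ "ball p r"])
    show "\<forall>\<^sub>F z in at p within ball 0 1. f z = zor_poly f p z / (z - p)"
      using r(1,4) by (auto simp: eventually_at dist_commute intro!: exI[of _ r])
  qed (fact r(3))
next
  case False
  then show ?thesis
    using assms(2) that by (auto simp: disc_simple_pole_def)
qed

text \<open>
  The product is the modulus of \<open>deriv h z - h z / (z - p)\<close>, in which only the second term is
  unbounded.
\<close>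

lemma scaled_deriv_at_simple_pole:
  fixes h :: "complex \<Rightarrow> complex"
  assumes "h analytic_on {p}" and "h p \<noteq> 0"
  shows "filterlim (\<lambda>z. norm (z - p) * norm (deriv (\<lambda>w. h w / (w - p)) z)) at_top (at p)"
proof -
  from assms(1) obtain S where S: "open S" "p \<in> S" "h holomorphic_on S"
    by (auto simp: analytic_at)
  have lim: "((\<lambda>z. - deriv h z) \<longlongrightarrow> - deriv h p) (at p)"
    using analytic_at_imp_isCont[OF analytic_deriv[OF assms(1)]] by (intro tendsto_minus isContD)
  have "is_pole (\<lambda>z. h z / (z - p)) p"
    using is_pole_basic[of h S p 1] S assms(2) by simp
  then have "filterlim (\<lambda>z. norm (- deriv h z + h z / (z - p))) at_top (at p)"
    unfolding is_pole_def
    by (intro filterlim_at_infinity_imp_norm_at_top tendsto_add_filterlim_at_infinity[OF lim])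
  moreover have "\<forall>\<^sub>F z in at p. norm (- deriv h z + h z / (z - p)) =
      norm (z - p) * norm (deriv (\<lambda>w. h w / (w - p)) z)"
  proof -
    have "\<forall>\<^sub>F z in at p. z \<in> S - {p}"
      using S by (auto simp: eventually_at_topological)
    then show ?thesis
    proof eventually_elim
      case (elim z)
      then have "(h has_field_derivative deriv h z) (at z)"
        using S holomorphic_derivI by blast
      then have "deriv (\<lambda>w. h w / (w - p)) z
          = (deriv h z * (z - p) - h z) / ((z - p) * (z - p))"
        using elim by (intro DERIV_imp_deriv) (auto intro!: derivative_eq_intros)
      then have "(z - p) * deriv (\<lambda>w. h w / (w - p)) z = - (- deriv h z + h z / (z - p))"
        using elim by (simp add: divide_simps mult_ac)
      then show ?case
        by (metis norm_minus_cancel norm_mult)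
    qed
  qed
  ultimately show ?thesis
    by (rule filterlim_cong[OF refl refl, THEN iffD1, rotated])
qed

text \<open>
  The ball has \<open>l\<close> on its boundary and lies inside the ball about the origin through \<open>l\<close>.  The
  point \<open>m\<close> is avoided because the ball has diameter at most \<open>dist l m\<close>.
\<close>

lemma radial_ball_subset_punctured_disc:
  fixes l m :: complex
  assumes l: "norm l \<le> 1" and s: "0 < s" "s < 1" and m: "2 * (s * norm l) \<le> dist l m"
  shows "ball (l - of_real s * l) (s * norm l) \<subseteq> ball 0 1 - {l, m}"
proof
  fix z assume "z \<in> ball (l - of_real s * l) (s * norm l)"
  then have z: "norm (l - of_real s * l - z) < s * norm l"
    by (simp add: dist_norm)
  have sl: "norm (of_real s * l) = s * norm l"
    using s by (simp add: norm_mult)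
  have "norm (l - of_real s * l) = (1 - s) * norm l"
  proof -
    have "l - of_real s * l = of_real (1 - s) * l"
      by (simp add: algebra_simps)
    then show ?thesis
      using s by (simp only: norm_mult norm_of_real)
  qed
  moreover have "norm z \<le> norm (l - of_real s * l) + norm (l - of_real s * l - z)"
    by (metis norm_minus_commute norm_triangle_sub)
  ultimately have "norm z < norm l"
    using z by (simp add: algebra_simps)
  moreover have "z \<noteq> m"
  proof
    assume "z = m"
    have "l - m = (l - of_real s * l - m) + of_real s * l"
      by simp
    then have "norm (l - m) \<le> norm (l - of_real s * l - m) + s * norm l"
      by (metis norm_triangle_ineq sl)
    with z m \<open>z = m\<close> show False
      by (simp add: dist_norm)
  qed
  ultimately show "z \<in> ball 0 1 - {l, m}"
    using l by auto
qed

text \<open>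
  Bloch's theorem with centre \<open>a s = (1 - s) l\<close> and radius \<open>s * norm l\<close>, the distance from
  \<open>a s\<close> to the pole, for \<open>s\<close> small.
\<close>

lemma simple_pole_image_contains_large_ball:
  fixes l m :: complex
  assumes l: "l \<in> cball 0 1 - {0}" and "l \<noteq> m"
    and mero: "f meromorphic_on ball 0 1"
    and holo: "f analytic_on (ball 0 1 - {l, m})"
    and pole: "disc_simple_pole f l"
  shows "\<exists>c. ball c r \<subseteq> f ` (ball 0 1 - {l, m})"
proof -
  obtain h where h: "h analytic_on {l}" "h l \<noteq> 0"
      "\<forall>\<^sub>F z in at l within ball 0 1. f z = h z / (z - l)"
    using disc_simple_pole_factor[OF mero pole] .
  from h(3) obtain U where U: "open U" "l \<in> U"
      and feq: "\<And>z. z \<in> U \<Longrightarrow> z \<noteq> l \<Longrightarrow> z \<in> ball 0 1 \<Longrightarrow> f z = h z / (z - l)"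
    unfolding eventually_at_topological by blast
  define a where "a s = l - of_real s * l" for s :: real
  have "filterlim a (at l) (at_right 0)"
    unfolding a_def filterlim_at
  proof
    show "\<forall>\<^sub>F s in at_right 0. l - of_real s * l \<in> UNIV \<and> l - of_real s * l \<noteq> l"
      using eventually_at_right_less[of 0] by eventually_elim (use l in auto)
    show "((\<lambda>s. l - of_real s * l) \<longlongrightarrow> l) (at_right 0)"
      by (auto intro!: tendsto_eq_intros)
  qed
  moreover have "\<forall>\<^sub>F z in at l. z \<in> U \<and> 2 * dist z l < dist l m \<and>
      12 * r \<le> norm (z - l) * norm (deriv (\<lambda>w. h w / (w - l)) z)"
  proof (intro eventually_conj)
    show "\<forall>\<^sub>F z in at l. z \<in> U"
      using U by (auto simp: eventually_at_topological)
    show "\<forall>\<^sub>F z in at l. 2 * dist z l < dist l m"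
      using \<open>l \<noteq> m\<close> by (auto simp: eventually_at intro!: exI[of _ "dist l m / 2"])
    show "\<forall>\<^sub>F z in at l. 12 * r \<le> norm (z - l) * norm (deriv (\<lambda>w. h w / (w - l)) z)"
      using scaled_deriv_at_simple_pole[OF h(1,2)] by (simp add: filterlim_at_top)
  qed
  ultimately have "\<forall>\<^sub>F s in at_right 0. a s \<in> U \<and> 2 * dist (a s) l < dist l m \<and>
      12 * r \<le> norm (a s - l) * norm (deriv (\<lambda>w. h w / (w - l)) (a s))"
    by (rule eventually_compose_filterlim[rotated])
  then have "\<forall>\<^sub>F s in at_right 0. 0 < s \<and> s < 1 \<and> a s \<in> U \<and> 2 * dist (a s) l < dist l m \<and>
      12 * r \<le> norm (a s - l) * norm (deriv (\<lambda>w. h w / (w - l)) (a s))"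
    using eventually_at_right_real[of 0 "1::real"] by (auto elim: eventually_elim2)
  then obtain s where s: "0 < s" "s < 1" "a s \<in> U" "2 * dist (a s) l < dist l m"
      "12 * r \<le> norm (a s - l) * norm (deriv (\<lambda>w. h w / (w - l)) (a s))"
    using eventually_happens'[OF trivial_limit_at_right_real] by blast
  have na: "norm (a s - l) = s * norm l"
    using s by (simp add: a_def norm_mult)
  have sub: "ball (a s) (s * norm l) \<subseteq> ball 0 1 - {l, m}"
    unfolding a_def using l s na by (intro radial_ball_subset_punctured_disc) (auto simp: dist_norm)
  have pos: "0 < s * norm l"
    using l s by simp
  have "deriv f (a s) = deriv (\<lambda>w. h w / (w - l)) (a s)"
  proof (rule deriv_cong_ev)
    have "a s \<in> U \<inter> (ball 0 1 - {l})"
      using subsetD[OF sub, of "a s"] pos s(3) by simp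
    moreover have "open (U \<inter> (ball 0 1 - {l}))"
      using U(1) by (intro open_Int open_delete) auto
    \<comment> \<open>The derivative needs the factorization in a full neighbourhood of \<open>a s\<close>; it is available
      because \<open>a s\<close> is inside the disc, even when \<open>l\<close> is on the circle.\<close>
    ultimately have "\<forall>\<^sub>F z in nhds (a s). z \<in> U \<inter> (ball 0 1 - {l})"
      by (metis eventually_nhds_in_open)
    then show "\<forall>\<^sub>F z in nhds (a s). f z = h z / (z - l)"
      by eventually_elim (use feq in auto)
  qed (rule refl)
  then have "r \<le> s * norm l * norm (deriv f (a s)) / 12"
    using s(5) na by simp
  moreover have "f holomorphic_on ball (a s) (s * norm l)"
    using analytic_imp_holomorphic[OF holo] sub by (rule holomorphic_on_subset)
  ultimately obtain b where "ball b r \<subseteq> f ` ball (a s) (s * norm l)"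
    using Bloch[OF _ pos] by blast
  then show ?thesis
    using sub by blast
qed

theorem corollary3p1:
  fixes l m :: complex
  assumes "l \<in> cball 0 1 - {0}" and "m \<in> cball 0 1 - {0}" and "l \<noteq> m"
  shows "landau_constant l m = \<infinity>"
proof -
  have "landau_radius l m f = top" if f: "f \<in> class_M1 l m" for f
  proof (rule ccontr)
    assume "landau_radius l m f \<noteq> top"
    then obtain n :: nat where n: "landau_radius l m f < of_nat n"
      using ennreal_Ex_less_of_nat by (auto simp: top.not_eq_extremum)
    then have "n > 0"
      by (cases n) auto
    moreover have "\<exists>c. ball c (real n) \<subseteq> f ` (ball 0 1 - {l, m})"
      using f assms by (intro simple_pole_image_contains_large_ball) (auto simp: class_M1_def)
    ultimately have "ennreal (real n) \<le> landau_radius l m f"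
      unfolding landau_radius_def by (intro Sup_upper) (auto intro!: exI[of _ "real n"])
    with n show False
      by (simp add: ennreal_of_nat_eq_real_of_nat)
  qed
  then show ?thesis
    by (simp add: landau_constant_def)
qed

end
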